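(* Let $G_2=\{(z_1+z_2,z_1z_2): z_1,z_2\in\mathbb{D}\}\subseteq\mathbb{C}^2$, let $\Omega$ be the convex hull of $G_2$, and let $d=(1,2)$. Let $0<r<1$ be such that the closed polydisc $\overline{\mathbb{D}^2(0,r)}$ is contained in $\Omega$, let $Q=(0,r)$, and let $0<\epsilon<r$ be such that the ball $\mathbb{B}^2(Q,\epsilon)$ is contained in $\Omega$. Put $K=\partial\mathbb{D}^2(0,r)\setminus\mathbb{B}^2(Q,\epsilon)$ and $D=\Omega\setminus K$. Then the $d$-balanced squeezing function $S_{d,D}^{\Omega}$ is not plurisubharmonic on $D$.
   Context: $\mathbb{D}$ is the open unit disc in $\mathbb{C}$; $\mathbb{D}^2(0,r)=\{(z_1,z_2)\in\mathbb{C}^2:|z_1|<r,|z_2|<r\}$ and $\partial\mathbb{D}^2(0,r)$ is its topological boundary; $\mathbb{B}^2(Q,\epsilon)$ is the open Euclidean ball of radius $\epsilon$ centered at $Q$ in $\mathbb{C}^2$. For an $n$-tuple $d=(d_1,\dots,d_n)$ of positive integers, $n\ge 2$, a domain $\Omega\subseteq\mathbb{C}^n$ is $d$-balanced if $(\lambda^{d_1}z_1,\dots,\lambda^{d_n}z_n)\in\Omega$ for all $z\in\Omega$ and all $\lambda\in\overline{\mathbb{D}}$. Its $d$-Minkowski function is $h_{d,\Omega}(z)=\inf\{t>0:(z_1/t^{d_1},\dots,z_n/t^{d_n})\in\Omega\}$, $z\in\mathbb{C}^n$, and for $\rho>0$ one sets $\Omega^d(\rho)=\{z\in\mathbb{C}^n:h_{d,\Omega}(z)<\rho\}$.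 For a bounded domain $D\subseteq\mathbb{C}^n$ and a bounded, convex, $d$-balanced domain $\Omega\subseteq\mathbb{C}^n$, let $\mathcal{O}_u(D,\Omega)$ be the set of injective holomorphic maps $D\to\Omega$. The $d$-balanced squeezing function is $$S_{d,D}^{\Omega}(z)=\sup\{\rho:\Omega^d(\rho)\subseteq f(D),\ f\in\mathcal{O}_u(D,\Omega),\ f(z)=0\},\qquad z\in D.$$ In the setting of the claim, $\Omega$ is a bounded, convex, $(1,2)$-balanced domain, $K$ is compact and $D$ is a bounded domain (in particular connected). *)

theory Defs
  imports "HOL-Analysis.Analysis"
begin

text \<open>Holomorphic maps on an open set: real Frechet differentiable with complex linear derivative.\<close>

definition holomorphic_map_on :: "(complex^'n \<Rightarrow> complex^'m) \<Rightarrow> (complex^'n) set \<Rightarrow> bool" where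
  "holomorphic_map_on f D \<longleftrightarrow>
     (\<forall>z\<in>D. \<exists>f'. (f has_derivative f') (at z) \<and> Vector_Spaces.linear (*s) (*s) f')"

definition minkowski_fun :: "nat^'n \<Rightarrow> (complex^'n) set \<Rightarrow> complex^'n \<Rightarrow> real" where
  "minkowski_fun d \<Omega> z = Inf {t. t > 0 \<and> (\<chi> i. z $ i / complex_of_real t ^ (d $ i)) \<in> \<Omega>}"

definition minkowski_ball :: "nat^'n \<Rightarrow> (complex^'n) set \<Rightarrow> real \<Rightarrow> (complex^'n) set" where
  "minkowski_ball d \<Omega> \<rho> = {z. minkowski_fun d \<Omega> z < \<rho>}"

text \<open>The notion is meant for a bounded domain \<open>D\<close> and a bounded, convex, \<open>d\<close>-balanced
  domain \<open>\<Omega>\<close>. The set below is then nonempty and bounded above by 1, so the real supremum is the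
  genuine one.\<close>

definition squeezing_fun ::
    "nat^'n \<Rightarrow> (complex^'n) set \<Rightarrow> (complex^'n) set \<Rightarrow> complex^'n \<Rightarrow> real" where
  "squeezing_fun d \<Omega> D z =
     Sup {\<rho>. \<rho> > 0 \<and> (\<exists>f. holomorphic_map_on f D \<and> inj_on f D \<and> f ` D \<subseteq> \<Omega> \<and> f z = 0 \<and>
                        minkowski_ball d \<Omega> \<rho> \<subseteq> f ` D)}"

definition upper_semicontinuous_on :: "'a::topological_space set \<Rightarrow> ('a \<Rightarrow> ereal) \<Rightarrow> bool" where
  "upper_semicontinuous_on D u \<longleftrightarrow> (\<forall>x\<in>D. \<forall>c>u x. \<forall>\<^sub>F y in at x within D. u y < c)"

text \<open>Mean over a circle, as the integral of the positive part minus that of the negative part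
  (\<^const>\<open>e2ennreal\<close> sends negative numbers to 0). For \<open>u\<close> upper semicontinuous and less than
  \<open>\<infinity>\<close> the former is finite, so the difference is meaningful, possibly \<open>-\<infinity>\<close>.\<close>

definition circle_mean :: "(complex \<Rightarrow> ereal) \<Rightarrow> complex \<Rightarrow> real \<Rightarrow> ereal" where
  "circle_mean u a s =
     (enn2ereal (\<integral>\<^sup>+t\<in>{0..2*pi}. e2ennreal (u (a + of_real s * cis t)) \<partial>lborel)
      - enn2ereal (\<integral>\<^sup>+t\<in>{0..2*pi}. e2ennreal (- u (a + of_real s * cis t)) \<partial>lborel))
     / ereal (2 * pi)"

text \<open>The constant \<open>-\<infinity>\<close> is allowed as a subharmonic function, and accordingly as a
  plurisubharmonic one.\<close>

definition subharmonic_on :: "complex set \<Rightarrow> (complex \<Rightarrow> ereal) \<Rightarrow> bool" where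
  "subharmonic_on U u \<longleftrightarrow>
     upper_semicontinuous_on U u \<and> (\<forall>z\<in>U. u z < \<infinity>) \<and>
     (\<forall>a s. s > 0 \<longrightarrow> cball a s \<subseteq> U \<longrightarrow> u a \<le> circle_mean u a s)"

definition plurisubharmonic_on :: "(complex^'n) set \<Rightarrow> (complex^'n \<Rightarrow> ereal) \<Rightarrow> bool" where
  "plurisubharmonic_on D u \<longleftrightarrow>
     upper_semicontinuous_on D u \<and> (\<forall>z\<in>D. u z < \<infinity>) \<and>
     (\<forall>a\<in>D. \<forall>b. subharmonic_on {\<zeta>. a + \<zeta> *s b \<in> D} (\<lambda>\<zeta>. u (a + \<zeta> *s b)))"

definition polydisc :: "complex^'n \<Rightarrow> real \<Rightarrow> (complex^'n) set" where
  "polydisc c r = {z. \<forall>i. norm (z $ i - c $ i) < r}"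

definition symmetrized_bidisc :: "(complex^2) set" where
  "symmetrized_bidisc = {vector [z1 + z2, z1 * z2] | z1 z2. norm z1 < 1 \<and> norm z2 < 1}"

end

(* Consider the analytic disc {(\<epsilon>, w) : |w| < r}. Its interior lies in D, while its whole boundary
   circle lies in K. On D the squeezing function S is positive, but S(\<epsilon>, w) tends to 0 as |w| tends
   to r, so the mean value inequality at (\<epsilon>, 0) fails on circles of radius close to r.

   For the decay of S, let f : D -> \<Omega> be injective holomorphic with f(\<epsilon>, w) = 0. The hole of K at Q
   makes the Hartogs phenomenon available: f(\<epsilon>, _) extends to a bounded holomorphic map G on a disc
   of radius s > r. For |k| = r the value G(k) is not in f(D), since f is open (invariance of domain)
   and injective and G(k) is a limit of values of f at points tending to (\<epsilon>, k), which is not in D.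
   Hence f(D) cannot contain \<Omega>^d(\<rho>) unless \<rho> is at most h(G(k)), and G(k) is within O(|k - w|)
   of G(w) = 0, with a constant not depending on f. *)

theory Submission
  imports Defs "HOL-Complex_Analysis.Conformal_Mappings"
begin

section \<open>Contour integrals depending on a parameter\<close>

text \<open>Pulled back to \<open>{0..1}\<close>, the integral has a jointly continuous integrand.
  This is why the derivative of the path is assumed continuous on all of
  \<open>{0..1}\<close>.\<close>

lemma continuous_on_contour_integral_param:
  fixes g :: "'a::topological_space \<Rightarrow> complex \<Rightarrow> complex"
  assumes cont: "continuous_on (U \<times> path_image \<gamma>) (\<lambda>(x, w). g x w)"
    and \<gamma>: "path \<gamma>" "continuous_on {0..1} (\<lambda>t. vector_derivative \<gamma> (at t))"
  shows "continuous_on U (\<lambda>x. contour_integral \<gamma> (g x))"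
proof -
  have "continuous_on (U \<times> cbox 0 1) (\<lambda>(x, t). g x (\<gamma> t))"
  proof -
    have "continuous_on (U \<times> cbox 0 1) ((\<lambda>(x, w). g x w) \<circ> (\<lambda>(x, t). (x, \<gamma> t)))"
    proof (rule continuous_on_compose)
      have "continuous_on (U \<times> cbox 0 1) (\<lambda>x. \<gamma> (snd x))"
        by (rule continuous_on_compose2[OF \<gamma>(1)[unfolded path_def]]) (auto intro!: continuous_intros)
      then show "continuous_on (U \<times> cbox 0 1) (\<lambda>(x, t). (x, \<gamma> t))"
        by (auto simp: split_beta intro!: continuous_intros)
      show "continuous_on ((\<lambda>(x, t). (x, \<gamma> t)) ` (U \<times> cbox 0 1)) (\<lambda>(x, w). g x w)"
        by (rule continuous_on_subset[OF cont]) (auto simp: path_image_def)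
    qed
    then show ?thesis by (simp add: o_def split_beta)
  qed
  moreover have "continuous_on (U \<times> cbox 0 1) (\<lambda>x. vector_derivative \<gamma> (at (snd x)))"
    by (rule continuous_on_compose2[OF \<gamma>(2)]) (auto intro!: continuous_intros)
  ultimately have "continuous_on (U \<times> cbox 0 1)
      (\<lambda>(x, t). g x (\<gamma> t) * vector_derivative \<gamma> (at t))"
    by (auto simp: split_beta intro!: continuous_intros)
  from integral_continuous_on_param[OF this] show ?thesis
    by (simp add: contour_integral_integral)
qed

text \<open>By Morera: the integral over a triangle in \<open>U\<close> can be exchanged with the
  circle integral, and the inner triangle integral then vanishes by Cauchy's theorem. It serves to
  show that a Cauchy integral in the second variable is holomorphic in the first.\<close>

lemma holomorphic_on_circle_integral_param:
  assumes "open U" "0 \<le> s"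
    and cont: "continuous_on (U \<times> sphere a s) (\<lambda>(x, w). g x w)"
    and hol: "\<And>w. w \<in> sphere a s \<Longrightarrow> (\<lambda>x. g x w) holomorphic_on U"
  shows "(\<lambda>x. contour_integral (circlepath a s) (g x)) holomorphic_on U"
proof -
  let ?\<gamma> = "circlepath a s"
  have vd\<gamma>: "continuous_on {0..1} (\<lambda>t. vector_derivative ?\<gamma> (at t))"
    by (auto simp: vector_derivative_circlepath intro!: continuous_intros)
  have vdl: "continuous_on {0..1} (\<lambda>t. vector_derivative (linepath u v) (at t))" for u v :: complex
    by (auto intro!: continuous_intros)
  have "(\<lambda>x. contour_integral ?\<gamma> (g x)) analytic_on U"
  proof (rule Morera_triangle)
    show "continuous_on U (\<lambda>x. contour_integral ?\<gamma> (g x))"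
      using cont vd\<gamma> \<open>0 \<le> s\<close> by (intro continuous_on_contour_integral_param) auto
    show "open U" by fact
    fix u v w
    show "convex hull {u, v, w} \<subseteq> U \<longrightarrow>
       contour_integral (linepath u v) (\<lambda>x. contour_integral ?\<gamma> (g x)) +
       contour_integral (linepath v w) (\<lambda>x. contour_integral ?\<gamma> (g x)) +
       contour_integral (linepath w u) (\<lambda>x. contour_integral ?\<gamma> (g x)) = 0"
    proof
      assume hull: "convex hull {u, v, w} \<subseteq> U"
      define T where "T p q = contour_integral (linepath p q)" for p q :: complex
      \<comment> \<open>Fubini for a single side; the integrability lets the three sides be added
        under the circle integral.\<close>
      have side: "T p q (\<lambda>x. contour_integral ?\<gamma> (g x)) = contour_integral ?\<gamma> (\<lambda>z. T p q (\<lambda>x. g x z))"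
        "(\<lambda>z. T p q (\<lambda>x. g x z)) contour_integrable_on ?\<gamma>"
        if "p \<in> {u, v, w}" "q \<in> {u, v, w}" for p q
      proof -
        have "closed_segment p q \<subseteq> convex hull {u, v, w}"
          unfolding segment_convex_hull using that by (intro hull_mono) auto
        then have seg: "closed_segment p q \<subseteq> U" using hull by auto
        have c: "continuous_on (closed_segment p q \<times> sphere a s) (\<lambda>(x, w). g x w)"
          using cont seg by (rule_tac continuous_on_subset) auto
        show "T p q (\<lambda>x. contour_integral ?\<gamma> (g x)) = contour_integral ?\<gamma> (\<lambda>z. T p q (\<lambda>x. g x z))"
          unfolding T_def using c vd\<gamma> vdl \<open>0 \<le> s\<close> by (intro contour_integral_swap) auto
        have "continuous_on (sphere a s) (\<lambda>z. T p q (\<lambda>x. g x z))"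
          unfolding T_def
        proof (rule continuous_on_contour_integral_param)
          have "continuous_on (sphere a s \<times> closed_segment p q) ((\<lambda>(x, w). g x w) \<circ> prod.swap)"
            using c by (intro continuous_on_compose continuous_on_swap) (auto simp: product_swap)
          then show "continuous_on (sphere a s \<times> path_image (linepath p q)) (\<lambda>(x, w). g w x)"
            by (simp add: o_def split_beta)
        qed (use vdl in auto)
        then show "(\<lambda>z. T p q (\<lambda>x. g x z)) contour_integrable_on ?\<gamma>"
          using \<open>0 \<le> s\<close> by (intro contour_integrable_continuous_circlepath) auto
      qed
      have 0: "T u v (\<lambda>x. g x z) + T v w (\<lambda>x. g x z) + T w u (\<lambda>x. g x z) = 0" if "z \<in> sphere a s" for z
        unfolding T_def
        by (intro has_chain_integral_chain_integral3 Cauchy_theorem_triangle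
            holomorphic_on_subset[OF hol hull] that)
      have "T u v (\<lambda>x. contour_integral ?\<gamma> (g x)) + T v w (\<lambda>x. contour_integral ?\<gamma> (g x))
          + T w u (\<lambda>x. contour_integral ?\<gamma> (g x))
        = contour_integral ?\<gamma> (\<lambda>z. T u v (\<lambda>x. g x z) + T v w (\<lambda>x. g x z) + T w u (\<lambda>x. g x z))"
        by (simp add: side contour_integral_add contour_integrable_add)
      also have "\<dots> = contour_integral ?\<gamma> (\<lambda>z. 0)"
        using 0 \<open>0 \<le> s\<close> by (intro contour_integral_cong) auto
      finally show "contour_integral (linepath u v) (\<lambda>x. contour_integral ?\<gamma> (g x)) +
          contour_integral (linepath v w) (\<lambda>x. contour_integral ?\<gamma> (g x)) +
          contour_integral (linepath w u) (\<lambda>x. contour_integral ?\<gamma> (g x)) = 0"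
        by (simp add: T_def)
    qed
  qed
  then show ?thesis by (rule analytic_imp_holomorphic)
qed

section \<open>Hartogs extension across the boundary of a polydisc\<close>

text \<open>\<open>E\<close> models the domain in pair notation: two shells around the bidisc of
  radius \<open>r\<close>, its interior, and a hole at \<open>(0, r)\<close> joining the two. The
  hole ties the values of \<open>\<phi>\<close> inside to those outside. Radius \<open>r\<close> is
  excluded in the conclusion because \<open>(c, w)\<close> may then lie outside
  \<open>E\<close>.\<close>

lemma hartogs_extension:
  fixes \<phi> :: "complex \<Rightarrow> complex \<Rightarrow> complex" and E :: "(complex \<times> complex) set"
  assumes "0 < r" "r < s" "0 < e"
    and out1: "\<And>x y. r < norm x \<Longrightarrow> norm x \<le> s \<Longrightarrow> norm y \<le> s \<Longrightarrow> (x, y) \<in> E"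
    and out2: "\<And>x y. norm x \<le> s \<Longrightarrow> r < norm y \<Longrightarrow> norm y \<le> s \<Longrightarrow> (x, y) \<in> E"
    and inside: "\<And>x y. norm x < r \<Longrightarrow> norm y < r \<Longrightarrow> (x, y) \<in> E"
    and hole: "\<And>x y. norm x < e \<Longrightarrow> dist (of_real r) y < e \<Longrightarrow> (x, y) \<in> E"
    and cont: "continuous_on E (\<lambda>(x, y). \<phi> x y)"
    and hol1: "\<And>y. (\<lambda>x. \<phi> x y) holomorphic_on {x. (x, y) \<in> E}"
    and hol2: "\<And>x. \<phi> x holomorphic_on {y. (x, y) \<in> E}"
    and "norm c < r"
  shows "\<exists>G. G holomorphic_on ball 0 s \<and>
    (\<forall>w. norm w < s \<and> norm w \<noteq> r \<longrightarrow> G w = \<phi> c w)"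
proof -
  \<comment> \<open>The Cauchy integral in the second variable. Its circle of radius
    \<open>s\<close> lies in the outer shell for every \<open>x\<close> with
    \<open>norm x < s\<close>, so \<open>F\<close> is defined across the wall.\<close>
  define F where "F x y = contour_integral (circlepath 0 s) (\<lambda>z. \<phi> x z / (z - y)) / (2 * pi * \<i>)" for x y
  have "0 < s" using assms by simp
  have circ: "(x, z) \<in> E" if "norm x < s" "z \<in> sphere 0 s" for x z
    using out2[of x z] that \<open>r < s\<close> by auto
  have contx: "continuous_on (sphere 0 s) (\<phi> x)" if "norm x < s" for x
  proof -
    have "continuous_on (sphere 0 s) ((\<lambda>(x, y). \<phi> x y) \<circ> Pair x)"
      using circ[OF that]
      by (intro continuous_on_compose continuous_intros continuous_on_subset[OF cont]) auto
    then show ?thesis by (simp add: o_def)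
  qed
  have F2: "F x holomorphic_on ball 0 s" if "norm x < s" for x
  proof -
    have "(\<lambda>y. contour_integral (circlepath 0 s) (\<lambda>z. \<phi> x z / (z - y))) holomorphic_on ball 0 s"
    proof (rule holomorphic_onI)
      fix y :: complex assume y: "y \<in> ball 0 s"
      \<comment> \<open>The exponent 1 is kept in order to match
        \<open>Cauchy_next_derivative_circlepath\<close>, which differentiates under the
        integral.\<close>
      have 1: "((\<lambda>u. \<phi> x u / (u - w) ^ 1) has_contour_integral
          contour_integral (circlepath 0 s) (\<lambda>z. \<phi> x z / (z - w))) (circlepath 0 s)"
        if "w \<in> ball 0 s" for w
        unfolding power_one_right
        using contx[OF \<open>norm x < s\<close>] that \<open>0 < s\<close>
        by (intro has_contour_integral_integral contour_integrable_continuous_circlepath)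
          (auto intro!: continuous_intros)
      show "(\<lambda>y. contour_integral (circlepath 0 s) (\<lambda>z. \<phi> x z / (z - y)))
          field_differentiable at y within ball 0 s"
        using Cauchy_next_derivative_circlepath(2)[OF _ 1, of y] contx[OF that] y \<open>0 < s\<close>
        by (auto simp: field_differentiable_def intro: has_field_derivative_at_within)
    qed
    then show ?thesis unfolding F_def by (auto intro!: holomorphic_intros)
  qed
  have F1: "(\<lambda>x. F x y) holomorphic_on ball 0 s" if "norm y < s" for y
  proof -
    have "(\<lambda>x. contour_integral (circlepath 0 s) (\<lambda>z. \<phi> x z / (z - y))) holomorphic_on ball 0 s"
    proof (rule holomorphic_on_circle_integral_param)
      have "continuous_on (ball 0 s \<times> sphere 0 s) (\<lambda>(x, z). \<phi> x z)"
        using circ by (intro continuous_on_subset[OF cont]) auto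
      then show "continuous_on (ball 0 s \<times> sphere 0 s) (\<lambda>(x, z). \<phi> x z / (z - y))"
        using that by (auto simp: split_beta intro!: continuous_intros)
      show "(\<lambda>x. \<phi> x w / (w - y)) holomorphic_on ball 0 s" if "w \<in> sphere 0 s" for w
        using circ that \<open>norm y < s\<close>
        by (intro holomorphic_intros holomorphic_on_subset[OF hol1[of w]]) auto
    qed (use \<open>0 < s\<close> in auto)
    then show ?thesis unfolding F_def by (auto intro!: holomorphic_intros)
  qed
  text \<open>\<open>F\<close> agrees with \<open>\<phi>\<close> on the shells outside the polydisc, hence (through the hole) near
    \<open>(0, r)\<close>, and from there inside the polydisc, by the identity theorem in one variable at a time.\<close>
  have A: "F x y = \<phi> x y" if "r < norm x" "norm x < s" "norm y < s" for x y
  proof -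
    have "\<phi> x holomorphic_on cball 0 s"
      using out1 that by (intro holomorphic_on_subset[OF hol2[of x]]) auto
    then have "((\<lambda>u. \<phi> x u / (u - y)) has_contour_integral 2 * of_real pi * \<i> * \<phi> x y) (circlepath 0 s)"
      using that by (intro Cauchy_integral_circlepath holomorphic_on_imp_continuous_on)
        (auto intro: holomorphic_on_subset)
    then show ?thesis unfolding F_def by (simp add: contour_integral_unique)
  qed
  have ring: "{z :: complex. r < norm z} \<inter> ball 0 s \<noteq> {}"
  proof -
    have "of_real ((r + s) / 2) \<in> {z :: complex. r < norm z} \<inter> ball 0 s"
      unfolding Int_iff mem_Collect_eq mem_ball dist_0_norm norm_of_real using \<open>0 < r\<close> \<open>r < s\<close> by auto
    then show ?thesis by blast
  qed
  have open_ring: "open {z :: complex. r < norm z}"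
    by (intro open_Collect_less continuous_intros)
  have B: "F x y = \<phi> x y" if x: "norm x < s" and y: "r < norm y" "norm y < s" for x y
  proof (rule analytic_continuation_open[where s = "{x. r < norm x} \<inter> ball 0 s" and s' = "ball 0 s"
        and f = "\<lambda>x. F x y" and g = "\<lambda>x. \<phi> x y"])
    show "(\<lambda>x. F x y) holomorphic_on ball 0 s" by (rule F1[OF y(2)])
    show "(\<lambda>x. \<phi> x y) holomorphic_on ball 0 s"
      using out2 y by (intro holomorphic_on_subset[OF hol1[of y]]) auto
    show "F z y = \<phi> z y" if "z \<in> {x. r < norm x} \<inter> ball 0 s" for z
      using that y by (intro A) auto
    show "open ({x :: complex. r < norm x} \<inter> ball 0 s)"
      by (intro open_Int open_ring open_ball)
  qed (use x ring in auto)
  have C: "F x y = \<phi> x y" if x: "norm x < e" "norm x < s" and y: "dist (of_real r) y < e" "norm y < s" for x y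
  proof (rule analytic_continuation_open[where s = "{y. r < norm y} \<inter> (ball 0 s \<inter> ball (of_real r) e)"
        and s' = "ball 0 s \<inter> ball (of_real r) e" and f = "F x" and g = "\<phi> x"])
    \<comment> \<open>The point \<open>r + \<delta>\<close> lies both in the outer shell and in the
      hole, so the set on which \<open>B\<close> gives agreement is nonempty.\<close>
    define \<delta> where "\<delta> = min (s - r) e / 2"
    have "0 < \<delta>" "\<delta> < s - r" "\<delta> < e" using \<open>r < s\<close> \<open>0 < e\<close> by (auto simp: \<delta>_def)
    then have "of_real (r + \<delta>) \<in> {y :: complex. r < norm y} \<inter> (ball 0 s \<inter> ball (of_real r) e)"
      unfolding Int_iff mem_Collect_eq mem_ball dist_norm diff_0 norm_minus_cancel norm_of_real of_real_diff[symmetric]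
      using \<open>0 < r\<close> by auto
    then show "{y :: complex. r < norm y} \<inter> (ball 0 s \<inter> ball (of_real r) e) \<noteq> {}" by blast
    show "F x holomorphic_on ball 0 s \<inter> ball (of_real r) e"
      using F2 x by (auto intro: holomorphic_on_subset)
    show "\<phi> x holomorphic_on ball 0 s \<inter> ball (of_real r) e"
      using hole x by (intro holomorphic_on_subset[OF hol2[of x]]) auto
  qed (use B x y open_ring in \<open>auto intro!: convex_connected convex_Int\<close>)
  have D: "F x y = \<phi> x y" if "norm x < r" "norm y < r" "dist (of_real r) y < e" for x y
  proof (rule analytic_continuation_open[where s = "ball 0 (min e r)" and s' = "ball 0 r"
        and f = "\<lambda>x. F x y" and g = "\<lambda>x. \<phi> x y"])
    show "(\<lambda>x. F x y) holomorphic_on ball 0 r"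
      using F1[of y] that \<open>r < s\<close> by (auto intro: holomorphic_on_subset)
    show "(\<lambda>x. \<phi> x y) holomorphic_on ball 0 r"
      using inside that by (intro holomorphic_on_subset[OF hol1[of y]]) auto
  qed (use C that \<open>0 < r\<close> \<open>0 < e\<close> \<open>r < s\<close> in auto)
  have I: "F x y = \<phi> x y" if "norm x < r" "norm y < r" for x y
  proof (rule analytic_continuation_open[where s = "ball 0 r \<inter> ball (of_real r) e" and s' = "ball 0 r"
        and f = "F x" and g = "\<phi> x"])
    \<comment> \<open>This time the overlap is on the inner side of the wall, witnessed by
      \<open>r - \<delta>\<close>.\<close>
    define \<delta> where "\<delta> = min r e / 2"
    have "0 < \<delta>" "\<delta> < r" "\<delta> < e" using \<open>0 < r\<close> \<open>0 < e\<close> by (auto simp: \<delta>_def)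
    then have "of_real (r - \<delta>) \<in> ball (0::complex) r \<inter> ball (of_real r) e"
      unfolding Int_iff mem_ball dist_norm diff_0 norm_minus_cancel norm_of_real of_real_diff[symmetric]
      using \<open>0 < r\<close> by auto
    then show "ball (0::complex) r \<inter> ball (of_real r) e \<noteq> {}" by blast
    show "F x holomorphic_on ball 0 r"
      using F2[of x] that \<open>r < s\<close> by (auto intro: holomorphic_on_subset)
    show "\<phi> x holomorphic_on ball 0 r"
      using inside that by (intro holomorphic_on_subset[OF hol2[of x]]) auto
  qed (use D that in auto)
  have "F c w = \<phi> c w" if "norm w < s" "norm w \<noteq> r" for w
    using I[of c w] B[of c w] that \<open>norm c < r\<close> \<open>r < s\<close> by (cases "norm w < r") auto
  then show ?thesis
    using F2[of c] \<open>norm c < r\<close> \<open>r < s\<close> by (intro exI[of _ "F c"]) auto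
qed

section \<open>Estimates in one variable and boundary values\<close>

text \<open>Cauchy's estimate bounds the derivative on the smaller disc, which is convex. The
  constant depends only on \<open>M\<close>, \<open>r\<close> and \<open>s\<close>, so it will be
  uniform over all competing maps.\<close>

lemma bounded_holomorphic_lipschitz:
  fixes G :: "complex \<Rightarrow> complex"
  assumes hol: "G holomorphic_on ball 0 s" and M: "\<And>w. w \<in> ball 0 s \<Longrightarrow> norm (G w) < M"
    and "r < s" "norm x \<le> r" "norm y \<le> r"
  shows "norm (G x - G y) \<le> 2 * M / (s - r) * norm (x - y)"
proof (rule field_differentiable_bound[where S = "cball 0 r" and f' = "deriv G"])
  fix z :: complex assume "z \<in> cball 0 r"
  then have z: "norm z \<le> r" by simp
  \<comment> \<open>Half the gap keeps the closed disc about \<open>z\<close> inside the open disc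
    of radius \<open>s\<close>, and \<open>M / \<delta>\<close> is the stated constant.\<close>
  define \<delta> where "\<delta> = (s - r) / 2"
  have \<delta>: "0 < \<delta>" "s = r + 2 * \<delta>" using \<open>r < s\<close> by (auto simp: \<delta>_def field_simps)
  have sub: "cball z \<delta> \<subseteq> ball 0 s"
  proof
    fix w assume "w \<in> cball z \<delta>"
    then have "norm (w - z) \<le> \<delta>" by (simp add: dist_norm norm_minus_commute)
    then have "norm w < s" using norm_triangle_ineq2[of w z] z \<delta> by linarith
    then show "w \<in> ball 0 s" by simp
  qed
  have "z \<in> ball 0 s" using z \<open>r < s\<close> by simp
  then show "(G has_field_derivative deriv G z) (at z within cball 0 r)"
    using hol by (meson holomorphic_derivI has_field_derivative_at_within open_ball)
  have "norm ((deriv ^^ 1) G z) \<le> fact 1 * M / \<delta> ^ 1"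
  proof (rule Cauchy_higher_deriv_bound[where y = 0])
    show "G holomorphic_on ball z \<delta>" "continuous_on (cball z \<delta>) G"
      using sub hol by (auto intro: holomorphic_on_subset holomorphic_on_imp_continuous_on
          dest: subset_trans[OF ball_subset_cball])
    show "G w \<in> ball 0 M" if "w \<in> ball z \<delta>" for w
      using that sub M by (auto simp: subset_eq)
  qed (use \<delta> in auto)
  then show "norm (deriv G z) \<le> 2 * M / (s - r)" by (simp add: \<delta>_def mult.commute)
qed (use assms in auto)

text \<open>A preimage \<open>x\<close> of \<open>y\<close> can be separated from \<open>k\<close>
  by a neighbourhood \<open>U\<close>. The image of \<open>D \<inter> U\<close> is open by
  invariance of domain, so it eventually contains \<open>f (v n)\<close>; injectivity forces
  \<open>v n\<close> into \<open>U\<close>, although \<open>v n\<close> tends to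
  \<open>k\<close>.\<close>

lemma boundary_value_notin_image:
  fixes f :: "'a::euclidean_space \<Rightarrow> 'a"
  assumes "continuous_on D f" "inj_on f D" "open D" "k \<notin> D"
    and v: "\<And>n. v n \<in> D" "v \<longlonglongrightarrow> k" and fv: "(\<lambda>n. f (v n)) \<longlonglongrightarrow> y"
  shows "y \<notin> f ` D"
proof
  assume "y \<in> f ` D"
  then obtain x where x: "x \<in> D" "y = f x" by auto
  with \<open>k \<notin> D\<close> have "x \<noteq> k" by auto
  then obtain U V where UV: "open U" "open V" "x \<in> U" "k \<in> V" "U \<inter> V = {}"
    by (meson hausdorff)
  have "open (f ` (D \<inter> U))"
    using assms UV by (intro invariance_of_domain open_Int) (auto intro: continuous_on_subset inj_on_subset)
  then have "\<forall>\<^sub>F n in sequentially. f (v n) \<in> f ` (D \<inter> U)"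
    using fv x UV by (auto dest: topological_tendstoD)
  moreover have "\<forall>\<^sub>F n in sequentially. v n \<in> V"
    using v UV by (auto dest: topological_tendstoD)
  ultimately have "\<forall>\<^sub>F n in sequentially. False"
  proof eventually_elim
    case (elim n)
    then obtain u where "u \<in> D" "u \<in> U" "f (v n) = f u" by auto
    then have "v n = u" using v(1)[of n] \<open>inj_on f D\<close> by (auto dest: inj_onD)
    then show ?case using elim UV \<open>u \<in> U\<close> by auto
  qed
  then show False by simp
qed

text \<open>Only the positive part has to be bounded, since subtracting the negative part lowers the
  difference. The assumption \<open>0 \<le> \<eta>\<close> is what makes
  \<open>ennreal \<eta>\<close> a faithful bound.\<close>

lemma circle_mean_le:
  assumes "0 \<le> \<eta>" "\<And>t. u (a + of_real s * cis t) \<le> ereal \<eta>"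
  shows "circle_mean u a s \<le> ereal \<eta>"
proof -
  let ?A = "\<integral>\<^sup>+t\<in>{0..2*pi}. e2ennreal (u (a + of_real s * cis t)) \<partial>lborel"
  let ?B = "\<integral>\<^sup>+t\<in>{0..2*pi}. e2ennreal (- u (a + of_real s * cis t)) \<partial>lborel"
  have "?A \<le> (\<integral>\<^sup>+t\<in>{0..2*pi}. ennreal \<eta> \<partial>lborel)"
    using assms(2)[THEN e2ennreal_mono] by (intro nn_integral_mono mult_right_mono) auto
  also have "\<dots> = ennreal (\<eta> * (2 * pi))"
    using \<open>0 \<le> \<eta>\<close> by (subst nn_integral_cmult_indicator) (auto simp: ennreal_mult)
  finally have "enn2ereal ?A \<le> ereal (\<eta> * (2 * pi))"
    using \<open>0 \<le> \<eta>\<close> by (simp add: less_eq_ennreal.rep_eq)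
  then have "enn2ereal ?A - enn2ereal ?B \<le> ereal (\<eta> * (2 * pi))"
    by (intro ereal_diff_le_mono_left) auto
  then have "circle_mean u a s \<le> ereal (\<eta> * (2 * pi)) / ereal (2 * pi)"
    unfolding circle_mean_def by (intro ereal_divide_right_mono) auto
  then show ?thesis by simp
qed

section \<open>Holomorphic maps of several variables\<close>

lemma holomorphic_map_on_continuous_on:
  assumes "holomorphic_map_on f D"
  shows "continuous_on D f"
proof (rule continuous_at_imp_continuous_on, rule ballI)
  fix z assume "z \<in> D"
  then obtain f' where "(f has_derivative f') (at z)"
    using assms unfolding holomorphic_map_on_def by blast
  then show "isCont f z" by (rule has_derivative_continuous)
qed

lemma holomorphic_map_on_line:
  fixes f :: "complex^'n \<Rightarrow> complex^'m"
  assumes "holomorphic_map_on f D"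
  shows "(\<lambda>\<zeta>. f (a + \<zeta> *s b) $ j) holomorphic_on {\<zeta>. a + \<zeta> *s b \<in> D}"
proof (rule holomorphic_onI)
  fix \<zeta> assume "\<zeta> \<in> {\<zeta>. a + \<zeta> *s b \<in> D}"
  then obtain f' where f': "(f has_derivative f') (at (a + \<zeta> *s b))" and lin: "Vector_Spaces.linear (*s) (*s) f'"
    using assms unfolding holomorphic_map_on_def by blast
  have "linear (\<lambda>h. h *s b)"
    by (rule linearI) (auto simp: vec_eq_iff algebra_simps)
  then have "((\<lambda>\<zeta>. a + \<zeta> *s b) has_derivative (\<lambda>h. 0 + h *s b)) (at \<zeta>)"
    by (intro has_derivative_add has_derivative_const linear_imp_has_derivative)
  then have "((\<lambda>\<zeta>. a + \<zeta> *s b) has_derivative (\<lambda>h. h *s b)) (at \<zeta>)" by simp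
  from has_derivative_compose[OF this f']
  have "((\<lambda>\<zeta>. f (a + \<zeta> *s b) $ j) has_derivative (\<lambda>h. f' (h *s b) $ j)) (at \<zeta>)"
    by (rule bounded_linear.has_derivative[OF bounded_linear_vec_nth])
  \<comment> \<open>Complex linearity of \<open>f'\<close> enters here: it turns the real derivative
    along the line into multiplication by a complex number.\<close>
  moreover have "f' (h *s b) $ j = f' b $ j * h" for h
    using module_hom.scale[OF Vector_Spaces.linear.axioms(3)[OF lin]]
    by (simp only: vector_smult_component mult.commute)
  ultimately have "((\<lambda>\<zeta>. f (a + \<zeta> *s b) $ j) has_field_derivative f' b $ j) (at \<zeta>)"
    by (simp add: has_field_derivative_def)
  then show "(\<lambda>\<zeta>. f (a + \<zeta> *s b) $ j) field_differentiable at \<zeta> within {\<zeta>. a + \<zeta> *s b \<in> D}"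
    by (auto simp: field_differentiable_def intro: has_field_derivative_at_within)
qed

section \<open>Minkowski balls against Euclidean balls\<close>

lemma norm_scaled_component_le:
  fixes z :: "complex^'n" and d :: "nat^'n"
  assumes "1 \<le> t" "\<And>i. 0 < d $ i"
  shows "norm (\<chi> i. z $ i / complex_of_real t ^ (d $ i)) \<le> norm z / t"
proof -
  have "norm (\<chi> i. z $ i / complex_of_real t ^ (d $ i)) \<le> norm ((1 / t) *\<^sub>R z)"
  proof (rule norm_le_componentwise_cart)
    fix i
    have "t ^ 1 \<le> t ^ (d $ i)" using assms(2)[of i] \<open>1 \<le> t\<close> by (intro power_increasing) auto
    then have "norm (z $ i) / t ^ (d $ i) \<le> norm (z $ i) / t"
      using \<open>1 \<le> t\<close> by (intro divide_left_mono mult_pos_pos) auto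
    then show "norm ((\<chi> i. z $ i / complex_of_real t ^ (d $ i)) $ i) \<le> norm (((1 / t) *\<^sub>R z) $ i)"
      using \<open>1 \<le> t\<close> by (simp add: norm_divide norm_power)
  qed
  then show ?thesis using \<open>1 \<le> t\<close> by simp
qed

text \<open>A point of small Minkowski value is obtained from a point of the bounded set
  \<open>\<Omega>\<close> by multiplying the coordinates by \<open>t ^ (d $ i)\<close>, which is at
  most \<open>t\<close> when \<open>t \<le> 1\<close>.\<close>

lemma minkowski_ball_subset_ball:
  fixes \<Omega> :: "(complex^'n) set"
  assumes "bounded \<Omega>" "ball 0 a \<subseteq> \<Omega>" "0 < a" "\<And>i. 0 < d $ i" "0 < \<eta>"
  obtains \<rho> where "0 < \<rho>" "minkowski_ball d \<Omega> \<rho> \<subseteq> ball 0 \<eta>"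
proof -
  obtain M where "0 < M" and M: "\<And>z. z \<in> \<Omega> \<Longrightarrow> norm z \<le> M"
    using \<open>bounded \<Omega>\<close> by (meson bounded_pos)
  \<comment> \<open>The cap at 1 makes powers of \<open>t < \<rho>\<close> decrease in the
    exponent.\<close>
  define \<rho> where "\<rho> = min 1 (\<eta> / M)"
  have \<rho>: "0 < \<rho>" "\<rho> \<le> 1" "\<rho> * M \<le> \<eta>"
    using \<open>0 < M\<close> \<open>0 < \<eta>\<close> by (auto simp: \<rho>_def min_def field_simps)
  have "norm z < \<eta>" if "minkowski_fun d \<Omega> z < \<rho>" for z
  proof -
    let ?T = "{t. t > 0 \<and> (\<chi> i. z $ i / complex_of_real t ^ (d $ i)) \<in> \<Omega>}"
    \<comment> \<open>This \<open>t\<close> only shows that the set under \<open>Inf\<close> is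
      nonempty: the scaled point has norm at most \<open>a / 2\<close>. Without nonemptiness,
      \<open>minkowski_fun d \<Omega> z < \<rho>\<close> would yield no admissible scaling.\<close>
    define t where "t = max 1 (2 * norm z / a)"
    have "norm z / t < a"
      using \<open>0 < a\<close> by (auto simp: t_def max_def field_simps)
    with norm_scaled_component_le[of t d z] assms(4)
    have "norm (\<chi> i. z $ i / complex_of_real t ^ (d $ i)) < a"
      by (auto simp: t_def)
    then have "t \<in> ?T" using assms(2) by (auto simp: t_def)
    then have "?T \<noteq> {}" by blast
    with that[unfolded minkowski_fun_def] obtain t where t: "t \<in> ?T" "t < \<rho>"
      by (meson cInf_lessD)
    then have "norm (t *\<^sub>R (\<chi> i. z $ i / complex_of_real t ^ (d $ i))) \<le> t * M"
      using M by (auto intro: mult_left_mono)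
    moreover have "norm z \<le> norm (t *\<^sub>R (\<chi> i. z $ i / complex_of_real t ^ (d $ i)))"
    proof (rule norm_le_componentwise_cart)
      fix i
      have "t ^ (d $ i) \<le> t ^ 1"
        using t \<rho> assms(4)[of i] by (intro power_decreasing) auto
      then have "norm (z $ i) \<le> t * (norm (z $ i) / t ^ (d $ i))"
        using t mult_left_mono[of "t ^ (d $ i)" t "norm (z $ i)"] by (simp add: field_simps)
      then show "norm (z $ i) \<le> norm ((t *\<^sub>R (\<chi> i. z $ i / complex_of_real t ^ (d $ i))) $ i)"
        using t by (simp add: norm_divide norm_power)
    qed
    moreover have "t * M < \<rho> * M" using t \<open>0 < M\<close> by simp
    ultimately show ?thesis using \<rho> by linarith
  qed
  then show thesis using that[of \<rho>] \<rho> by (auto simp: minkowski_ball_def subset_eq)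
qed

text \<open>The scaling at the fixed level \<open>\<rho> / 2\<close> is continuous and fixes 0, so
  it carries a small ball into \<open>\<Omega>\<close>, and there the Minkowski function is at most
  \<open>\<rho> / 2\<close>.\<close>

lemma ball_subset_minkowski_ball:
  fixes \<Omega> :: "(complex^'n) set"
  assumes "ball 0 a \<subseteq> \<Omega>" "0 < a" "0 < \<rho>"
  obtains \<eta> where "0 < \<eta>" "ball 0 \<eta> \<subseteq> minkowski_ball d \<Omega> \<rho>"
proof -
  define t where "t = \<rho> / 2"
  have t: "0 < t" "t < \<rho>" using \<open>0 < \<rho>\<close> by (auto simp: t_def)
  have "((\<lambda>z::complex^'n. \<chi> i. z $ i / complex_of_real t ^ (d $ i)) \<longlongrightarrow>
      (\<chi> i. (0::complex^'n) $ i / complex_of_real t ^ (d $ i))) (nhds 0)"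
    using t by (intro tendsto_intros tendsto_vec_lambda filterlim_ident) auto
  moreover have "(\<chi> i. (0::complex^'n) $ i / complex_of_real t ^ (d $ i)) \<in> ball 0 a"
    using \<open>0 < a\<close> by (simp add: zero_vec_def[symmetric])
  ultimately have "\<forall>\<^sub>F z::complex^'n in nhds 0. (\<chi> i. z $ i / complex_of_real t ^ (d $ i)) \<in> ball 0 a"
    by (rule topological_tendstoD[OF _ open_ball])
  then obtain \<eta> where \<eta>: "0 < \<eta>"
    "\<And>z::complex^'n. dist z 0 < \<eta> \<Longrightarrow> (\<chi> i. z $ i / complex_of_real t ^ (d $ i)) \<in> ball 0 a"
    unfolding eventually_nhds_metric by blast
  have "minkowski_fun d \<Omega> z < \<rho>" if "norm z < \<eta>" for z
  proof -
    have "minkowski_fun d \<Omega> z \<le> t"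
      unfolding minkowski_fun_def
    proof (rule cInf_lower)
      show "t \<in> {t. 0 < t \<and> (\<chi> i. z $ i / complex_of_real t ^ (d $ i)) \<in> \<Omega>}"
        using \<eta>(2)[of z] that t assms(1) by auto
    qed (auto intro!: bdd_belowI[of _ 0])
    with t show ?thesis by simp
  qed
  then show thesis using that[of \<eta>] \<eta>(1) by (auto simp: minkowski_ball_def subset_eq)
qed

section \<open>Positivity and finiteness of the squeezing function\<close>

text \<open>Named separately because the real \<open>Sup\<close> is meaningful only for a nonempty
  set bounded above, and these two facts are proved next.\<close>

definition squeezing_radii ::
    "nat^'n \<Rightarrow> (complex^'n) set \<Rightarrow> (complex^'n) set \<Rightarrow> complex^'n \<Rightarrow> real set" where
  "squeezing_radii d \<Omega> D z =
     {\<rho>. \<rho> > 0 \<and> (\<exists>f. holomorphic_map_on f D \<and> inj_on f D \<and> f ` D \<subseteq> \<Omega> \<and> f z = 0 \<and>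
                        minkowski_ball d \<Omega> \<rho> \<subseteq> f ` D)}"

lemma squeezing_fun_eq_Sup: "squeezing_fun d \<Omega> D z = Sup (squeezing_radii d \<Omega> D z)"
  by (simp add: squeezing_fun_def squeezing_radii_def)

text \<open>A point \<open>p\<close> outside \<open>\<Omega>\<close> is missed by the image of every
  competing map, so its Minkowski value caps all radii.\<close>

lemma bdd_above_squeezing_radii:
  fixes \<Omega> D :: "(complex^'n) set"
  assumes "bounded \<Omega>"
  shows "bdd_above (squeezing_radii d \<Omega> D z)"
proof -
  obtain p where "p \<notin> \<Omega>"
    using assms not_bounded_UNIV by (metis UNIV_eq_I)
  have "\<rho> \<le> minkowski_fun d \<Omega> p" if "\<rho> \<in> squeezing_radii d \<Omega> D z" for \<rho>
  proof (rule ccontr)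
    assume "\<not> ?thesis"
    then have "p \<in> minkowski_ball d \<Omega> \<rho>" by (simp add: minkowski_ball_def)
    with that \<open>p \<notin> \<Omega>\<close> show False unfolding squeezing_radii_def by blast
  qed
  then show ?thesis by (rule bdd_aboveI)
qed

text \<open>The competitor is a translation of \<open>z\<close> to 0 followed by a contraction
  strong enough to bring the bounded set \<open>D\<close> into \<open>ball 0 a\<close>.\<close>

lemma squeezing_radii_nonempty:
  fixes \<Omega> D :: "(complex^'n) set"
  assumes "bounded \<Omega>" "ball 0 a \<subseteq> \<Omega>" "0 < a" "\<And>i. 0 < d $ i"
    and "bounded D" "open D" "z \<in> D"
  shows "squeezing_radii d \<Omega> D z \<noteq> {}"
proof -
  obtain R where R: "0 < R" "\<And>w. w \<in> D \<Longrightarrow> dist z w \<le> R"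
    using \<open>bounded D\<close> by (metis bounded_any_center less_max_iff_disj max.coboundedI1 zero_less_one)
  obtain b where b: "0 < b" "ball z b \<subseteq> D"
    using \<open>open D\<close> \<open>z \<in> D\<close> openE by blast
  \<comment> \<open>All of \<open>D\<close> is within \<open>R\<close> of \<open>z\<close>, so the
    image has norm at most \<open>a / 2\<close>.\<close>
  define c where "c = a / (2 * R)"
  have "0 < c" "c * R < a" using R(1) \<open>0 < a\<close> by (auto simp: c_def field_simps)
  define f where "f w = c *\<^sub>R (w - z)" for w
  obtain \<rho> where \<rho>: "0 < \<rho>" "minkowski_ball d \<Omega> \<rho> \<subseteq> ball 0 (c * b)"
    using minkowski_ball_subset_ball[OF assms(1-4), where \<eta> = "c * b"] \<open>0 < c\<close> \<open>0 < b\<close> by auto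
  have "holomorphic_map_on f D"
    unfolding holomorphic_map_on_def
  proof (intro ballI exI conjI)
    show "(f has_derivative (\<lambda>h. c *\<^sub>R h)) (at w)" for w
      unfolding f_def by (auto intro!: derivative_eq_intros)
    show "Vector_Spaces.linear (*s) (*s) (\<lambda>h :: complex^_. c *\<^sub>R h)"
      by unfold_locales (auto simp: vec_eq_iff algebra_simps)
  qed
  moreover have "inj_on f D" using \<open>0 < c\<close> by (auto simp: inj_on_def f_def)
  moreover have "f ` D \<subseteq> \<Omega>"
  proof -
    have "norm (f w) < a" if "w \<in> D" for w
    proof -
      have "norm (f w) \<le> c * R"
        using R(2)[OF that] \<open>0 < c\<close> by (auto simp: f_def dist_norm norm_minus_commute)
      with \<open>c * R < a\<close> show ?thesis by simp
    qed
    then show ?thesis using assms(2) by (auto simp: subset_eq)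
  qed
  moreover have "f z = 0" by (simp add: f_def)
  moreover have "ball 0 (c * b) \<subseteq> f ` D"
  proof
    fix y :: "complex^'n" assume "y \<in> ball 0 (c * b)"
    then have "z + (1 / c) *\<^sub>R y \<in> D"
      using b \<open>0 < c\<close> by (intro subsetD[OF b(2)]) (auto simp: dist_norm field_simps)
    moreover have "f (z + (1 / c) *\<^sub>R y) = y" using \<open>0 < c\<close> by (simp add: f_def)
    ultimately show "y \<in> f ` D" by force
  qed
  ultimately have "\<rho> \<in> squeezing_radii d \<Omega> D z"
    unfolding squeezing_radii_def using \<rho> by blast
  then show ?thesis by blast
qed

lemma squeezing_fun_pos:
  fixes \<Omega> D :: "(complex^'n) set"
  assumes "bounded \<Omega>" "ball 0 a \<subseteq> \<Omega>" "0 < a" "\<And>i. 0 < d $ i"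
    and "bounded D" "open D" "z \<in> D"
  shows "0 < squeezing_fun d \<Omega> D z"
proof -
  obtain \<rho> where "\<rho> \<in> squeezing_radii d \<Omega> D z"
    using squeezing_radii_nonempty[of \<Omega> a d D z] assms by auto
  moreover from this have "0 < \<rho>" by (simp add: squeezing_radii_def)
  ultimately show ?thesis
    unfolding squeezing_fun_eq_Sup using bdd_above_squeezing_radii[OF assms(1)] cSup_upper
    by (meson less_le_trans)
qed

section \<open>Topology of the polydisc and of the symmetrized bidisc\<close>

lemma closure_polydisc:
  assumes "0 < r"
  shows "closure (polydisc c r) = {z. \<forall>i. norm (z $ i - c $ i) \<le> r}"
proof
  have "closed {z. \<forall>i. norm (z $ i - c $ i) \<le> r}"
    by (intro closed_Collect_all closed_Collect_le continuous_intros)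
  then show "closure (polydisc c r) \<subseteq> {z. \<forall>i. norm (z $ i - c $ i) \<le> r}"
    by (intro closure_minimal) (auto simp: polydisc_def less_imp_le)
  show "{z. \<forall>i. norm (z $ i - c $ i) \<le> r} \<subseteq> closure (polydisc c r)"
  proof
    fix z assume z: "z \<in> {z. \<forall>i. norm (z $ i - c $ i) \<le> r}"
    \<comment> \<open>\<open>z\<close> is approached along the segment from the centre, starting at
      \<open>c\<close> itself for \<open>n = 0\<close>.\<close>
    define v where "v n = c + (1 - 1 / real (Suc n)) *\<^sub>R (z - c)" for n
    have "v n \<in> polydisc c r" for n
    proof -
      have "norm (v n $ i - c $ i) < r" for i
      proof -
        have "norm (v n $ i - c $ i) = (1 - 1 / real (Suc n)) * norm (z $ i - c $ i)"
          by (simp add: v_def)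
        also have "\<dots> \<le> (1 - 1 / real (Suc n)) * r"
          using z by (intro mult_left_mono) auto
        also have "\<dots> < r" using \<open>0 < r\<close> by (simp add: field_simps)
        finally show ?thesis .
      qed
      then show ?thesis by (simp add: polydisc_def)
    qed
    moreover have "v \<longlonglongrightarrow> c + (1 - 0) *\<^sub>R (z - c)"
      unfolding v_def by (intro tendsto_intros LIMSEQ_Suc[OF lim_1_over_n])
    ultimately show "z \<in> closure (polydisc c r)"
      by (auto simp: closure_sequential)
  qed
qed

lemma open_polydisc: "open (polydisc c r)"
  unfolding polydisc_def Collect_all_eq
  by (intro open_INT ballI open_Collect_less continuous_intros) auto

lemma norm_vec_2_le: "norm x \<le> norm (x $ 1) + norm (x $ 2)" for x :: "'a::real_normed_vector^2"
  using L2_set_le_sum[of UNIV "\<lambda>i. norm (x $ i)"] by (simp add: norm_vec_def UNIV_2)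

lemma continuous_on_vector_2: "continuous_on A (\<lambda>(x, y). vector [x, y] :: 'a::{zero,topological_space}^2)"
proof -
  have "(vector [x, y] :: 'a^2) = (\<chi> i. if i = 1 then x else y)" for x y
    by (simp add: vec_eq_iff forall_2)
  moreover have "continuous_on A (\<lambda>p. if i = 1 then fst p else snd p)" for i :: 2
    by (cases "i = 1") (auto intro!: continuous_intros)
  then have "continuous_on A (\<lambda>p. \<chi> i :: 2. if i = 1 then fst p else snd p)"
    by (rule continuous_on_vec_lambda)
  ultimately show ?thesis by (simp add: split_beta)
qed

text \<open>Membership of \<open>y\<close> means that both roots of \<open>T^2 - y1 T + y2\<close>
  lie in the unit disc. The proof is a quantitative form of the continuity of roots in the
  coefficients.\<close>

lemma open_symmetrized_bidisc: "open symmetrized_bidisc"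
  unfolding open_contains_ball
proof
  fix x assume "x \<in> symmetrized_bidisc"
  then obtain z1 z2 where x: "x = vector [z1 + z2, z1 * z2]" and z: "norm z1 < 1" "norm z2 < 1"
    by (auto simp: symmetrized_bidisc_def)
  define \<rho> where "\<rho> = max (norm z1) (norm z2)"
  have \<rho>: "norm z1 \<le> \<rho>" "norm z2 \<le> \<rho>" "\<rho> < 1" using z by (auto simp: \<rho>_def)
  then have "0 \<le> \<rho>" using norm_ge_zero order_trans by blast
  \<comment> \<open>Chosen so that \<open>2 * \<delta>\<close> is the square of
    \<open>1 - \<rho>\<close>, the lower bound found below for a root of norm at least 1.\<close>
  define \<delta> where "\<delta> = (1 - \<rho>)\<^sup>2 / 2"
  have "0 < \<delta>" using \<rho> by (simp add: \<delta>_def)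
  moreover have "y \<in> symmetrized_bidisc" if "y \<in> ball x \<delta>" for y
  proof -
    have y: "norm (y $ i - x $ i) < \<delta>" for i
      using that Finite_Cartesian_Product.norm_nth_le[of "y - x" i] by (simp add: dist_norm norm_minus_commute)
    have root: "norm a < 1" if "a\<^sup>2 = y $ 1 * a - y $ 2" for a
    proof (rule ccontr)
      assume "\<not> norm a < 1"
      then have a: "1 \<le> norm a" by simp
      have far: "norm a * (1 - \<rho>) \<le> norm (a - u)" if "norm u \<le> \<rho>" for u
      proof -
        have "norm a - \<rho> \<le> norm (a - u)" using norm_triangle_ineq2[of a u] that by linarith
        moreover have "\<rho> * 1 \<le> \<rho> * norm a" using a \<open>0 \<le> \<rho>\<close> by (rule mult_left_mono)
        ultimately show ?thesis by (simp add: algebra_simps)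
      qed
      have "norm a * (1 - \<rho>)\<^sup>2 \<le> norm a * (norm a * (1 - \<rho>)\<^sup>2)"
        using a by (intro mult_left_mono) (auto simp: mult_ge1_I mult_le_cancel_right1)
      also have "\<dots> = (norm a * (1 - \<rho>)) * (norm a * (1 - \<rho>))"
        by (simp add: power2_eq_square)
      also have "\<dots> \<le> norm (a - z1) * norm (a - z2)"
        using \<rho> by (intro mult_mono far) auto
      \<comment> \<open>Since \<open>a\<close> is a root of the polynomial of \<open>y\<close>, the
        polynomial of \<open>x\<close> at \<open>a\<close> equals the difference of the two, which
        involves only the perturbation of the coefficients.\<close>
      also have "\<dots> = norm ((y $ 1 - x $ 1) * a - (y $ 2 - x $ 2))"
      proof -
        have "(a - z1) * (a - z2) = (y $ 1 - x $ 1) * a - (y $ 2 - x $ 2)"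
          using that by (simp add: x power2_eq_square) algebra
        then show ?thesis by (metis norm_mult)
      qed
      also have "\<dots> \<le> norm (y $ 1 - x $ 1) * norm a + norm (y $ 2 - x $ 2)"
        by (metis norm_mult norm_triangle_ineq4)
      also have "\<dots> < \<delta> * norm a + \<delta> * norm a"
      proof (rule add_strict_mono)
        show "norm (y $ 1 - x $ 1) * norm a < \<delta> * norm a"
          using y[of 1] a by (intro mult_strict_right_mono) auto
        show "norm (y $ 2 - x $ 2) < \<delta> * norm a"
          using y[of 2] mult_left_mono[OF a, of \<delta>] \<open>0 < \<delta>\<close> by linarith
      qed
      finally show False by (simp add: \<delta>_def)
    qed
    \<comment> \<open>The quadratic formula supplies the two roots whose sum and product are the
      coordinates of \<open>y\<close>.\<close>
    define q where "q = csqrt ((y $ 1)\<^sup>2 - 4 * y $ 2)"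
    have q: "q\<^sup>2 = (y $ 1)\<^sup>2 - 4 * y $ 2" by (simp add: q_def)
    have roots: "((y $ 1 + q) / 2)\<^sup>2 = y $ 1 * ((y $ 1 + q) / 2) - y $ 2"
        "((y $ 1 - q) / 2)\<^sup>2 = y $ 1 * ((y $ 1 - q) / 2) - y $ 2"
        "(y $ 1 + q) / 2 * ((y $ 1 - q) / 2) = y $ 2"
      using q by (simp_all add: power2_eq_square field_simps, algebra+)
    have "y = vector [(y $ 1 + q) / 2 + (y $ 1 - q) / 2, (y $ 1 + q) / 2 * ((y $ 1 - q) / 2)]"
      unfolding roots(3) by (simp add: vec_eq_iff forall_2 field_simps)
    with root[OF roots(1)] root[OF roots(2)] show ?thesis
      unfolding symmetrized_bidisc_def by blast
  qed
  ultimately show "\<exists>e>0. ball x e \<subseteq> symmetrized_bidisc" by blast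
qed

lemma bounded_symmetrized_bidisc: "bounded symmetrized_bidisc"
proof (rule boundedI)
  fix x assume "x \<in> symmetrized_bidisc"
  then obtain z1 z2 where x: "x = vector [z1 + z2, z1 * z2]" and z: "norm z1 < 1" "norm z2 < 1"
    by (auto simp: symmetrized_bidisc_def)
  have "norm (z1 + z2) \<le> 2" using z norm_triangle_ineq[of z1 z2] by linarith
  moreover have "norm (z1 * z2) \<le> 1" using z by (simp add: norm_mult mult_le_one)
  ultimately show "norm x \<le> 3" using norm_vec_2_le[of x] by (simp add: x)
qed

section \<open>Decay of the squeezing function at the wall\<close>

text \<open>This is \<open>hartogs_extension\<close> for each component of \<open>f\<close>, after
  passing from vectors to pairs.\<close>

lemma slice_extension:
  fixes f :: "complex^2 \<Rightarrow> complex^2"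
  assumes f: "holomorphic_map_on f D"
    and rse: "0 < r" "r < s" "0 < e"
    and out1: "\<And>x y. r < norm x \<Longrightarrow> norm x \<le> s \<Longrightarrow> norm y \<le> s \<Longrightarrow> vector [x, y] \<in> D"
    and out2: "\<And>x y. norm x \<le> s \<Longrightarrow> r < norm y \<Longrightarrow> norm y \<le> s \<Longrightarrow> vector [x, y] \<in> D"
    and inside: "\<And>x y. norm x < r \<Longrightarrow> norm y < r \<Longrightarrow> vector [x, y] \<in> D"
    and hole: "\<And>x y. norm x < e \<Longrightarrow> dist (of_real r) y < e \<Longrightarrow> vector [x, y] \<in> D"
    and c: "norm c < r"
  obtains G where "\<And>j. (\<lambda>w. G w $ j) holomorphic_on ball 0 s"
    "\<And>w. norm w < s \<Longrightarrow> norm w \<noteq> r \<Longrightarrow> G w = f (vector [c, w])"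
proof -
  have "\<exists>g. g holomorphic_on ball 0 s \<and>
    (\<forall>w. norm w < s \<and> norm w \<noteq> r \<longrightarrow> g w = f (vector [c, w]) $ j)" for j
  proof (rule hartogs_extension[where \<phi> = "\<lambda>x y. f (vector [x, y]) $ j" and
        E = "{(x, y). vector [x, y] \<in> D}", OF rse])
    have "continuous_on {(x, y). vector [x, y] \<in> D} (\<lambda>p. f ((\<lambda>(x, y). vector [x, y]) p))"
      by (rule continuous_on_compose2[OF holomorphic_map_on_continuous_on[OF f] continuous_on_vector_2]) auto
    then show "continuous_on {(x, y). vector [x, y] \<in> D} (\<lambda>(x, y). f (vector [x, y]) $ j)"
      by (simp add: split_beta continuous_on_component)
    have x: "vector [x, y] = vector [0, y] + x *s (vector [1, 0] :: complex^2)" for x y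
      by (simp add: vec_eq_iff forall_2)
    have y: "vector [x, y] = vector [x, 0] + y *s (vector [0, 1] :: complex^2)" for x y
      by (simp add: vec_eq_iff forall_2)
    show "(\<lambda>x. f (vector [x, y]) $ j) holomorphic_on {x. (x, y) \<in> {(x, y). vector [x, y] \<in> D}}" for y
      using holomorphic_map_on_line[OF f, of "vector [0, y]" "vector [1, 0]" j] by (simp flip: x)
    show "(\<lambda>y. f (vector [x, y]) $ j) holomorphic_on {y. (x, y) \<in> {(x, y). vector [x, y] \<in> D}}" for x
      using holomorphic_map_on_line[OF f, of "vector [x, 0]" "vector [0, 1]" j] by (simp flip: y)
  qed (use out1 out2 inside hole c in auto)
  then obtain g where "\<And>j. g j holomorphic_on ball 0 s"
    "\<And>j w. norm w < s \<Longrightarrow> norm w \<noteq> r \<Longrightarrow> g j w = f (vector [c, w]) $ j"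
    by metis
  then show thesis
    by (intro that[of "\<lambda>w. \<chi> j. g j w"]) (auto simp: vec_eq_iff)
qed

text \<open>The constants \<open>\<delta>\<close>, \<open>L\<close> and \<open>t\<close> are fixed
  before the competitor \<open>f\<close> is taken, so the bound passes to the supremum.\<close>

lemma squeezing_fun_near_wall:
  fixes \<Omega> D :: "(complex^2) set"
  assumes \<Omega>: "bounded \<Omega>" "ball 0 a \<subseteq> \<Omega>" "0 < a" "\<And>i. 0 < d $ i"
    and D: "D \<subseteq> \<Omega>" "open D"
    and rse: "0 < r" "r < s" "0 < e"
    and out1: "\<And>x y. r < norm x \<Longrightarrow> norm x \<le> s \<Longrightarrow> norm y \<le> s \<Longrightarrow> vector [x, y] \<in> D"
    and out2: "\<And>x y. norm x \<le> s \<Longrightarrow> r < norm y \<Longrightarrow> norm y \<le> s \<Longrightarrow> vector [x, y] \<in> D"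
    and inside: "\<And>x y. norm x < r \<Longrightarrow> norm y < r \<Longrightarrow> vector [x, y] \<in> D"
    and hole: "\<And>x y. norm x < e \<Longrightarrow> dist (of_real r) y < e \<Longrightarrow> vector [x, y] \<in> D"
    and c: "norm c < r" and wall: "\<And>w. norm w = r \<Longrightarrow> vector [c, w] \<notin> D"
    and "0 < \<eta>"
  shows "\<exists>t. 0 \<le> t \<and> t < r \<and>
    (\<forall>w. t < norm w \<longrightarrow> norm w < r \<longrightarrow> squeezing_fun d \<Omega> D (vector [c, w]) \<le> \<eta>)"
proof -
  obtain M where "0 < M" and M: "\<And>z. z \<in> \<Omega> \<Longrightarrow> norm z < M"
    using \<Omega>(1) by (metis bounded_pos_less)
  obtain \<delta> where \<delta>: "0 < \<delta>" "ball 0 \<delta> \<subseteq> minkowski_ball d \<Omega> \<eta>"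
    using ball_subset_minkowski_ball[OF \<Omega>(2,3) \<open>0 < \<eta>\<close>] by blast
  \<comment> \<open>The Lipschitz constant of each component of the extension \<open>G\<close>. On
    the circle of radius \<open>r\<close> the values of \<open>G\<close> are mere limits, bounded by
    \<open>M\<close> non-strictly; \<open>M + 1\<close> restores the strict bound that the Lipschitz
    lemma asks for.\<close>
  define L where "L = 2 * (M + 1) / (s - r)"
  have "0 < L" using \<open>0 < M\<close> \<open>r < s\<close> by (simp add: L_def)
  \<comment> \<open>Ensures \<open>2 * L * (r - norm w) < \<delta>\<close>, with the factor 2 for
    the two coordinates. The bound \<open>t \<ge> 0\<close> makes \<open>w\<close> nonzero.\<close>
  define t where "t = max 0 (r - \<delta> / (2 * L))"
  have t: "0 \<le> t" "t < r" "r - t \<le> \<delta> / (2 * L)"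
    using \<delta>(1) \<open>0 < L\<close> \<open>0 < r\<close> by (auto simp: t_def)
  have "squeezing_fun d \<Omega> D (vector [c, w]) \<le> \<eta>" if w: "t < norm w" "norm w < r" for w
    unfolding squeezing_fun_eq_Sup
  proof (rule cSup_least)
    have "vector [c, w] \<in> D" using inside c w by auto
    then show "squeezing_radii d \<Omega> D (vector [c, w]) \<noteq> {}"
      using squeezing_radii_nonempty[OF \<Omega>(1-4)] D bounded_subset[OF \<Omega>(1)] by blast
    fix \<rho> assume "\<rho> \<in> squeezing_radii d \<Omega> D (vector [c, w])"
    then obtain f where f: "holomorphic_map_on f D" "inj_on f D" "f ` D \<subseteq> \<Omega>"
        "f (vector [c, w]) = 0" "minkowski_ball d \<Omega> \<rho> \<subseteq> f ` D"
      unfolding squeezing_radii_def by blast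
    obtain G where G: "\<And>j. (\<lambda>w. G w $ j) holomorphic_on ball 0 s"
      "\<And>w. norm w < s \<Longrightarrow> norm w \<noteq> r \<Longrightarrow> G w = f (vector [c, w])"
      using slice_extension[OF f(1) rse out1 out2 inside hole c] by blast
    have contG: "continuous_on (ball 0 s) G"
      using continuous_on_vec_lambda[of "ball 0 s" "\<lambda>j w. G w $ j"] G(1)
      by (simp add: holomorphic_on_imp_continuous_on)
    have in_D: "vector [c, u] \<in> D" if "norm u < s" "norm u \<noteq> r" for u
      using inside[of c u] out2[of c u] that c \<open>r < s\<close> by (cases "norm u < r") auto
    \<comment> \<open>The radial projection of \<open>w\<close> to the wall, at distance
      \<open>r - norm w\<close>.\<close>
    define k where "k = of_real (r / norm w) * w"
    have "0 < norm w" using w t by linarith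
    then have k: "norm k = r" "k - w = of_real ((r - norm w) / norm w) * w"
      using \<open>0 < r\<close> by (auto simp: k_def norm_mult norm_divide field_simps)
    \<comment> \<open>Points of norm \<open>r + (s - r) / (n + 2)\<close>, tending to
      \<open>u\<close> from outside. Starting at 2 keeps even the first one strictly below
      \<open>s\<close>.\<close>
    define v where "v n u = of_real (1 + (s - r) / r / real (Suc (Suc n))) * u" for n and u :: complex
    have v: "r < norm (v n u)" "norm (v n u) < s" "(\<lambda>n. v n u) \<longlonglongrightarrow> u" if "norm u = r" for n u
    proof -
      define m where "m = real (Suc (Suc n))"
      have "1 < m" by (simp add: m_def)
      have "norm (v n u) = \<bar>1 + (s - r) / r / m\<bar> * r"
        using that unfolding v_def norm_mult norm_of_real m_def by simp
      also have "\<dots> = (1 + (s - r) / r / m) * r"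
        using rse \<open>1 < m\<close> by simp
      also have "\<dots> = r + (s - r) / m"
        using rse \<open>1 < m\<close> by (simp add: field_simps)
      finally have "norm (v n u) = r + (s - r) / m" .
      moreover have "(s - r) / m < s - r" "0 < (s - r) / m"
        using rse \<open>1 < m\<close> by (simp_all add: divide_less_eq)
      ultimately show "r < norm (v n u)" "norm (v n u) < s" by auto
      have "(\<lambda>n. of_real (1 + (s - r) / r * (1 / real (Suc (Suc n)))) * u) \<longlonglongrightarrow> of_real (1 + (s - r) / r * 0) * u"
        by (intro tendsto_intros LIMSEQ_Suc[OF LIMSEQ_Suc[OF lim_1_over_n]])
      then show "(\<lambda>n. v n u) \<longlonglongrightarrow> u" by (simp add: v_def)
    qed
    have Gv: "(\<lambda>n. f (vector [c, v n u])) \<longlonglongrightarrow> G u" if "norm u = r" for u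
    proof -
      have "(\<lambda>n. G (v n u)) \<longlonglongrightarrow> G u"
        by (rule continuous_on_tendsto_compose[OF contG v(3)[OF that]])
          (use v that rse in \<open>auto intro!: always_eventually\<close>)
      moreover have "G (v n u) = f (vector [c, v n u])" for n
        using v(1,2)[OF that, of n] by (intro G(2)) auto
      ultimately show ?thesis by simp
    qed
    have Gk: "G k \<notin> f ` D"
    proof (rule boundary_value_notin_image[where v = "\<lambda>n. vector [c, v n k]"])
      show "continuous_on D f" by (rule holomorphic_map_on_continuous_on[OF f(1)])
      show "vector [c, k] \<notin> D" using wall k by blast
      show "vector [c, v n k] \<in> D" for n
        using v(1,2)[OF k(1), of n] by (intro in_D) auto
      show "(\<lambda>n. vector [c, v n k] :: complex^2) \<longlonglongrightarrow> vector [c, k]"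
        using continuous_on_tendsto_compose[OF continuous_on_vector_2[of UNIV]
            tendsto_Pair[OF tendsto_const v(3)[OF k(1)]], of c] by simp
      show "(\<lambda>n. f (vector [c, v n k])) \<longlonglongrightarrow> G k" by (rule Gv[OF k(1)])
    qed (use f D in auto)
    have G_le: "norm (G u) < M + 1" if "norm u < s" for u
    proof (cases "norm u = r")
      case False
      then have "G u \<in> \<Omega>" using G(2) in_D that f(3) by auto
      then show ?thesis using M[of "G u"] by linarith
    next
      case True
      have "norm (f (vector [c, v n u])) \<le> M" for n
        using v(1,2)[OF True, of n] f(3) in_D by (intro less_imp_le M) auto
      then have "norm (G u) \<le> M"
        by (intro Lim_norm_ubound[OF _ Gv[OF True]]) auto
      then show ?thesis by simp
    qed
    have "norm (G k $ j - G w $ j) \<le> L * norm (k - w)" for j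
      unfolding L_def
    proof (rule bounded_holomorphic_lipschitz[OF G(1)])
      show "norm (G u $ j) < M + 1" if "u \<in> ball 0 s" for u
        using G_le[of u] Finite_Cartesian_Product.norm_nth_le[of "G u" j] that by auto
    qed (use k w rse in auto)
    moreover have "G w = 0" using G(2)[of w] w rse f(4) by simp
    moreover have "norm (k - w) = r - norm w"
      using w \<open>0 < norm w\<close> unfolding k(2) norm_mult norm_of_real by simp
    ultimately have "norm (G k) \<le> 2 * (L * (r - norm w))"
      using norm_vec_2_le[of "G k"] by (smt (verit) diff_zero zero_index)
    also have "\<dots> < \<delta>"
    proof -
      have "r - norm w < \<delta> / (2 * L)" using w t by linarith
      then show ?thesis using \<open>0 < L\<close> by (simp add: field_simps)
    qed
    \<comment> \<open>The Minkowski value of \<open>G k\<close> is below \<open>\<eta>\<close> and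
      at least \<open>\<rho>\<close>.\<close>
    finally have "G k \<in> minkowski_ball d \<Omega> \<eta>" using \<delta>(2) by auto
    moreover have "G k \<notin> minkowski_ball d \<Omega> \<rho>" using Gk f(5) by blast
    ultimately show "\<rho> \<le> \<eta>" by (simp add: minkowski_ball_def)
  qed
  with t show ?thesis by blast
qed

section \<open>The disc on which the mean value inequality fails\<close>

theorem theorem3p5:
  fixes \<Omega> K D :: "(complex^2) set" and Q :: "complex^2" and d :: "nat^2" and r \<epsilon> :: real
  assumes "\<Omega> = convex hull symmetrized_bidisc"
    and "d = vector [1, 2]"
    and "0 < r" and "r < 1"
    and "closure (polydisc 0 r) \<subseteq> \<Omega>"
    and "Q = vector [0, of_real r]"
    and "0 < \<epsilon>" and "\<epsilon> < r"
    and "ball Q \<epsilon> \<subseteq> \<Omega>"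
    and "K = frontier (polydisc 0 r) - ball Q \<epsilon>"
    and "D = \<Omega> - K"
  shows "\<not> plurisubharmonic_on D (\<lambda>z. ereal (squeezing_fun d \<Omega> D z))"
proof
  assume psh: "plurisubharmonic_on D (\<lambda>z. ereal (squeezing_fun d \<Omega> D z))"
  note \<Omega>_def = assms(1) and d_def = assms(2) and r = assms(3)
    and Q_def = assms(6) and \<epsilon> = assms(7,8) and K_def = assms(10) and D_def = assms(11)
  have \<Omega>: "open \<Omega>" "bounded \<Omega>"
    unfolding \<Omega>_def using open_symmetrized_bidisc bounded_symmetrized_bidisc
    by (auto intro: bounded_convex_hull)
  have cl: "closure (polydisc 0 r) = {z :: complex^2. norm (z $ 1) \<le> r \<and> norm (z $ 2) \<le> r}"
    using closure_polydisc[OF r, of "0 :: complex^2"] by (simp add: forall_2)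
  have pd: "polydisc 0 r = {z :: complex^2. norm (z $ 1) < r \<and> norm (z $ 2) < r}"
    by (simp add: polydisc_def forall_2)
  have fr: "frontier (polydisc 0 r) = closure (polydisc 0 r) - polydisc (0 :: complex^2) r"
    by (simp add: frontier_def interior_open open_polydisc)
  have cl\<Omega>: "vector [x, y] \<in> \<Omega>" if "norm x \<le> r" "norm y \<le> r" for x y
    using assms(5) that by (auto simp: cl)
  have "ball (0 :: complex^2) r \<subseteq> closure (polydisc 0 r)"
  proof
    fix z :: "complex^2" assume "z \<in> ball 0 r"
    then show "z \<in> closure (polydisc 0 r)"
      using Finite_Cartesian_Product.norm_nth_le[of z 1] Finite_Cartesian_Product.norm_nth_le[of z 2]
      by (auto simp: cl)
  qed
  then have ball\<Omega>: "ball 0 r \<subseteq> \<Omega>" using assms(5) by blast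
  have d: "0 < d $ i" for i
    using exhaust_2[of i] by (auto simp: d_def)
  have "closed K" unfolding K_def by (intro closed_Diff frontier_closed open_ball)
  then have D: "open D" "D \<subseteq> \<Omega>" "bounded D"
    unfolding D_def using \<Omega> by (auto intro: bounded_subset)
  have "compact (closure (polydisc (0 :: complex^2) r))"
    using assms(5) \<Omega>(2) by (meson bounded_subset closed_closure compact_eq_bounded_closed)
  \<comment> \<open>Compactness gives a uniform margin around the closed bidisc, hence room for the
    shells up to radius \<open>s\<close>.\<close>
  then obtain b where b: "0 < b" "(\<Union>z\<in>closure (polydisc 0 r). ball z b) \<subseteq> \<Omega>"
    using compact_subset_open_imp_ball_epsilon_subset \<Omega>(1) assms(5) by blast
  define s where "s = r + b / 4"
  have s: "r < s" "2 * (s - r) < b" using b(1) by (auto simp: s_def)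
  have bidisc_s: "vector [x, y] \<in> \<Omega>" if "norm x \<le> s" "norm y \<le> s" for x y
  proof -
    define z :: "complex^2" where "z = vector [x, y]"
    \<comment> \<open>Scaling by \<open>r / s\<close> brings the point into the closed bidisc and
      moves each coordinate by at most \<open>s - r\<close>, so the point by at most
      \<open>b / 2\<close>.\<close>
    have shrink: "norm ((r / s) *\<^sub>R w) \<le> r" "norm (w - (r / s) *\<^sub>R w) \<le> s - r" if "norm w \<le> s" for w :: complex
    proof -
      have "norm ((r / s) *\<^sub>R w) = r / s * norm w" using r s by simp
      also have "\<dots> \<le> r / s * s" using r s that by (intro mult_left_mono) auto
      finally show "norm ((r / s) *\<^sub>R w) \<le> r" using r s by simp
      have "w - (r / s) *\<^sub>R w = (1 - r / s) *\<^sub>R w" by (simp add: algebra_simps)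
      then have "norm (w - (r / s) *\<^sub>R w) = (1 - r / s) * norm w" using r s by simp
      also have "\<dots> \<le> (1 - r / s) * s" using r s that by (intro mult_left_mono) auto
      also have "\<dots> = s - r" using r s by (simp add: field_simps)
      finally show "norm (w - (r / s) *\<^sub>R w) \<le> s - r" .
    qed
    have "(r / s) *\<^sub>R z \<in> closure (polydisc 0 r)"
      using shrink(1) that unfolding cl by (simp add: z_def)
    moreover have "norm (z - (r / s) *\<^sub>R z) < b"
      using norm_vec_2_le[of "z - (r / s) *\<^sub>R z"] shrink(2)[OF that(1)] shrink(2)[OF that(2)] s(2)
      by (simp add: z_def)
    ultimately have "z \<in> \<Omega>"
      by (intro subsetD[OF b(2)]) (auto simp: dist_norm norm_minus_commute)
    then show ?thesis by (simp add: z_def)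
  qed
  have out1: "vector [x, y] \<in> D" if "r < norm x" "norm x \<le> s" "norm y \<le> s" for x y
    unfolding D_def K_def fr unfolding cl using bidisc_s that by auto
  have out2: "vector [x, y] \<in> D" if "norm x \<le> s" "r < norm y" "norm y \<le> s" for x y
    unfolding D_def K_def fr unfolding cl using bidisc_s that by auto
  have inside: "vector [x, y] \<in> D" if "norm x < r" "norm y < r" for x y
    unfolding D_def K_def fr unfolding cl unfolding pd using cl\<Omega> that by auto
  have hole: "vector [x, y] \<in> D" if "norm x < \<epsilon> / 2" "dist (of_real r) y < \<epsilon> / 2" for x y
  proof -
    have "dist Q (vector [x, y]) < \<epsilon>"
      using norm_vec_2_le[of "Q - vector [x, y]"] that by (simp add: Q_def dist_norm)
    then show ?thesis using assms(9) by (auto simp: D_def K_def)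
  qed
  \<comment> \<open>First coordinate \<open>\<epsilon>\<close> already forces distance at least
    \<open>\<epsilon>\<close> from \<open>Q\<close>, so this slice misses the open ball and its
    whole circle of radius \<open>r\<close> stays in \<open>K\<close>.\<close>
  have wall: "vector [of_real \<epsilon>, w] \<notin> D" if "norm w = r" for w
  proof -
    have "\<epsilon> \<le> dist Q (vector [of_real \<epsilon>, w])"
      using Finite_Cartesian_Product.norm_nth_le[of "Q - vector [of_real \<epsilon>, w]" 1] \<epsilon>
      by (simp add: Q_def dist_norm)
    then have "vector [of_real \<epsilon>, w] \<in> K"
      using that \<epsilon> unfolding K_def fr unfolding cl unfolding pd by auto
    then show ?thesis by (simp add: D_def)
  qed
  have c: "norm (of_real \<epsilon> :: complex) < r" using \<epsilon> by simp
  define S where "S w = squeezing_fun d \<Omega> D (vector [of_real \<epsilon>, w])" for w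
  have line: "vector [of_real \<epsilon>, 0] + w *s vector [0, 1] = (vector [of_real \<epsilon>, w] :: complex^2)" for w
    by (simp add: vec_eq_iff forall_2)
  have "vector [of_real \<epsilon>, 0] \<in> D" using inside c r by simp
  then have "0 < S 0"
    unfolding S_def using squeezing_fun_pos[OF \<Omega>(2) ball\<Omega> r d D(3,1)] by blast
  then have half: "0 < S 0 / 2" and \<epsilon>2: "0 < \<epsilon> / 2" using \<epsilon> by simp_all
  have "\<exists>t. 0 \<le> t \<and> t < r \<and> (\<forall>w. t < norm w \<longrightarrow> norm w < r \<longrightarrow>
      squeezing_fun d \<Omega> D (vector [of_real \<epsilon>, w]) \<le> S 0 / 2)"
    by (rule squeezing_fun_near_wall[where a = r and e = "\<epsilon> / 2" and s = s])
      (fact \<Omega> ball\<Omega> r d D s out1 out2 inside hole c wall half \<epsilon>2)+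
  then obtain t where t: "0 \<le> t" "t < r" "\<And>w. t < norm w \<Longrightarrow> norm w < r \<Longrightarrow> S w \<le> S 0 / 2"
    unfolding S_def by blast
  have "subharmonic_on {w. vector [of_real \<epsilon>, 0] + w *s vector [0, 1] \<in> D}
      (\<lambda>w. ereal (squeezing_fun d \<Omega> D (vector [of_real \<epsilon>, 0] + w *s vector [0, 1])))"
    using psh \<open>vector [of_real \<epsilon>, 0] \<in> D\<close> unfolding plurisubharmonic_on_def by blast
  then have sub: "subharmonic_on {w. vector [of_real \<epsilon>, w] \<in> D} (\<lambda>w. ereal (S w))"
    by (simp only: line S_def)
  \<comment> \<open>Any radius strictly between \<open>t\<close> and \<open>r\<close> serves: the
    closed disc lies in the slice of \<open>D\<close>, and on its boundary circle \<open>S\<close>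
    is at most half of \<open>S 0\<close>.\<close>
  define \<sigma> where "\<sigma> = (t + r) / 2"
  have \<sigma>: "0 < \<sigma>" "t < \<sigma>" "\<sigma> < r" using t r by (auto simp: \<sigma>_def)
  have "cball 0 \<sigma> \<subseteq> {w. vector [of_real \<epsilon>, w] \<in> D}"
    using inside c \<sigma> by auto
  then have "ereal (S 0) \<le> circle_mean (\<lambda>w. ereal (S w)) 0 \<sigma>"
    using sub \<sigma>(1) unfolding subharmonic_on_def by blast
  also have "\<dots> \<le> ereal (S 0 / 2)"
  proof (rule circle_mean_le)
    have "S (0 + of_real \<sigma> * cis u) \<le> S 0 / 2" for u
      using \<sigma> by (intro t(3)) (auto simp: norm_mult)
    then show "ereal (S (0 + of_real \<sigma> * cis u)) \<le> ereal (S 0 / 2)" for u by simp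
  qed (use half in simp)
  finally show False using \<open>0 < S 0\<close> by simp
qed

end
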